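(* Let $k_n=k_n(x)$ be an arbitrary (smooth) covariant vector field on $M$, and put $$N^k_n=-l^k\,\frac{\partial F}{\partial x^n}-F\,m^k\left(\frac{\partial\theta}{\partial x^n}-k_n\right),\qquad d_n=\frac{\partial}{\partial x^n}+N^k_n\frac{\partial}{\partial y^k},\qquad N^k{}_{nm}=\frac{\partial N^k_n}{\partial y^m},\qquad N^k{}_{nmi}=\frac{\partial N^k{}_{nm}}{\partial y^i}.$$ Then $$d_nF=0,\qquad d_n\theta=k_n,\qquad y_kN^k{}_{nmi}=0 .$$
   Context: $M$ is a 2-dimensional $C^\infty$ manifold; the consideration is local, in coordinates $x^1,x^2$ with induced fibre coordinates $y^1,y^2$ (no orientation-reversing changes). $F=F(x,y)$ is a Finsler metric function (positive, positively homogeneous of degree 1 in $y$, sufficiently smooth for $y\ne0$, with positive definite metric tensor), considered on an open conic region of nonzero tangent vectors. Notation: $l^k=y^k/F$, $y_k=F\,\partial F/\partial y^k$, $l_k=\partial F/\partial y^k=y_k/F$, $g_{ij}=\partial y_i/\partial y^j$, $g^{ij}$ its inverse. With $\gamma_{11}=\gamma_{22}=0$, $\gamma_{12}=-\gamma_{21}=1$, put $\epsilon_{ik}=\sqrt{\det(g_{mn})}\,\gamma_{ik}$, $m_i=-\epsilon_{ik}l^k$, $m^i=g^{ij}m_j$; then $g_{ij}=l_il_j+m_im_j$. The angle function $\theta=\theta(x,y)$ is a (smooth) function, positively homogeneous of degree zero in $y$, satisfying $F\,\partial\theta/\partial y^n=m_n$ on the region considered. Repeated indices (running over $1,2$) are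 summed. *)

theory Defs
  imports "HOL-Analysis.Analysis"
begin

text \<open>
  Everything is local: points and tangent vectors are given by their coordinates in
  \<open>real^2\<close>, and functions on (part of) the tangent bundle are curried functions of
  the base point \<open>x\<close> and the fibre coordinate \<open>y\<close>.
\<close>

type_synonym tfun = "real^2 \<Rightarrow> real^2 \<Rightarrow> real"

section \<open>Differentiability classes\<close>

text \<open>\<open>C_on r S f\<close>: on the open set \<open>S\<close> the map \<open>f\<close> is of class \<open>C^r\<close>.\<close>

fun C_on :: "nat \<Rightarrow> 'a::euclidean_space set \<Rightarrow> ('a \<Rightarrow> 'b::real_normed_vector) \<Rightarrow> bool" where
  "C_on 0 S f \<longleftrightarrow> continuous_on S f"
| "C_on (Suc r) S f \<longleftrightarrow>
     (\<forall>p\<in>S. f differentiable (at p)) \<and> (\<forall>v. C_on r S (\<lambda>p. frechet_derivative f (at p) v))"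

definition smooth_on :: "'a::euclidean_space set \<Rightarrow> ('a \<Rightarrow> 'b::real_normed_vector) \<Rightarrow> bool" where
  "smooth_on S f \<longleftrightarrow> (\<forall>r. C_on r S f)"

section \<open>Partial derivatives with respect to base and fibre coordinates\<close>

definition pdx :: "tfun \<Rightarrow> 2 \<Rightarrow> tfun" where
  "pdx f n x y = deriv (\<lambda>t. f (x + t *\<^sub>R axis n 1) y) 0"

definition pdy :: "tfun \<Rightarrow> 2 \<Rightarrow> tfun" where
  "pdy f n x y = deriv (\<lambda>t. f x (y + t *\<^sub>R axis n 1)) 0"

section \<open>The objects attached to a Finsler metric function\<close>

text \<open>In the names, \<open>up\<close> and \<open>low\<close> indicate upper and lower indices.\<close>

definition l_up :: "tfun \<Rightarrow> 2 \<Rightarrow> tfun" where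
  "l_up F k x y = y $ k / F x y"

definition y_low :: "tfun \<Rightarrow> 2 \<Rightarrow> tfun" where
  "y_low F k x y = F x y * pdy F k x y"

definition g_low :: "tfun \<Rightarrow> real^2 \<Rightarrow> real^2 \<Rightarrow> real^2^2" where
  "g_low F x y = (\<chi> i j. pdy (y_low F i) j x y)"

definition g_up :: "tfun \<Rightarrow> real^2 \<Rightarrow> real^2 \<Rightarrow> real^2^2" where
  "g_up F x y = matrix_inv (g_low F x y)"

definition gam :: "2 \<Rightarrow> 2 \<Rightarrow> real" where
  "gam i k = (if i = 1 \<and> k = 2 then 1 else if i = 2 \<and> k = 1 then - 1 else 0)"

definition eps :: "tfun \<Rightarrow> 2 \<Rightarrow> 2 \<Rightarrow> tfun" where
  "eps F i k x y = sqrt (det (g_low F x y)) * gam i k"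

definition m_low :: "tfun \<Rightarrow> 2 \<Rightarrow> tfun" where
  "m_low F i x y = - (\<Sum>k\<in>UNIV. eps F i k x y * l_up F k x y)"

definition m_up :: "tfun \<Rightarrow> 2 \<Rightarrow> tfun" where
  "m_up F i x y = (\<Sum>j\<in>UNIV. g_up F x y $ i $ j * m_low F j x y)"

section \<open>Standing assumptions\<close>

definition conic_region :: "(real^2) set \<Rightarrow> ((real^2) \<times> (real^2)) set \<Rightarrow> bool" where
  "conic_region U \<Omega> \<longleftrightarrow> open U \<and> open \<Omega> \<and> \<Omega> \<subseteq> U \<times> (- {0}) \<and>
     (\<forall>x y t. (x, y) \<in> \<Omega> \<longrightarrow> t > 0 \<longrightarrow> (x, t *\<^sub>R y) \<in> \<Omega>)"

text \<open>
  ``Sufficiently smooth'' is \<open>C^4\<close>: the metric tensor, and hence \<open>m^k\<close>, is then \<open>C^2\<close>,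
  as needed for two fibre derivatives of the connection coefficients.
\<close>

definition finsler_metric_on :: "((real^2) \<times> (real^2)) set \<Rightarrow> tfun \<Rightarrow> bool" where
  "finsler_metric_on \<Omega> F \<longleftrightarrow>
     C_on 4 \<Omega> (\<lambda>p. F (fst p) (snd p)) \<and>
     (\<forall>(x, y)\<in>\<Omega>. F x y > 0) \<and>
     (\<forall>(x, y)\<in>\<Omega>. \<forall>t>0. F x (t *\<^sub>R y) = t * F x y) \<and>
     (\<forall>(x, y)\<in>\<Omega>. \<forall>v. v \<noteq> 0 \<longrightarrow>
        (\<Sum>i\<in>UNIV. \<Sum>j\<in>UNIV. g_low F x y $ i $ j * v $ i * v $ j) > 0)"

text \<open>
  The equation \<open>F \<partial>\<theta>/\<partial>y^n = m_n\<close> makes \<open>\<theta>\<close> in general only \<open>C^3\<close> when \<open>F\<close> is \<open>C^4\<close>,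
  so no more is required of it.
\<close>

definition angle_function_on :: "((real^2) \<times> (real^2)) set \<Rightarrow> tfun \<Rightarrow> tfun \<Rightarrow> bool" where
  "angle_function_on \<Omega> F \<theta> \<longleftrightarrow>
     C_on 3 \<Omega> (\<lambda>p. \<theta> (fst p) (snd p)) \<and>
     (\<forall>(x, y)\<in>\<Omega>. \<forall>t>0. \<theta> x (t *\<^sub>R y) = \<theta> x y) \<and>
     (\<forall>(x, y)\<in>\<Omega>. \<forall>n. F x y * pdy \<theta> n x y = m_low F n x y)"

section \<open>The connection coefficients\<close>

text \<open>\<open>Ncoef F \<theta> \<kappa> k n\<close> is \<open>N^k_n\<close>; the first index is the upper one throughout.\<close>

definition Ncoef :: "tfun \<Rightarrow> tfun \<Rightarrow> (real^2 \<Rightarrow> real^2) \<Rightarrow> 2 \<Rightarrow> 2 \<Rightarrow> tfun" where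
  "Ncoef F \<theta> \<kappa> k n x y =
     - l_up F k x y * pdx F n x y - F x y * m_up F k x y * (pdx \<theta> n x y - \<kappa> x $ n)"

definition Ncoef1 :: "tfun \<Rightarrow> tfun \<Rightarrow> (real^2 \<Rightarrow> real^2) \<Rightarrow> 2 \<Rightarrow> 2 \<Rightarrow> 2 \<Rightarrow> tfun" where
  "Ncoef1 F \<theta> \<kappa> k n m = pdy (Ncoef F \<theta> \<kappa> k n) m"

definition Ncoef2 :: "tfun \<Rightarrow> tfun \<Rightarrow> (real^2 \<Rightarrow> real^2) \<Rightarrow> 2 \<Rightarrow> 2 \<Rightarrow> 2 \<Rightarrow> 2 \<Rightarrow> tfun" where
  "Ncoef2 F \<theta> \<kappa> k n m i = pdy (Ncoef1 F \<theta> \<kappa> k n m) i"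

text \<open>The operator \<open>d_n\<close>, applied to a function \<open>f\<close>.\<close>

definition d_op :: "tfun \<Rightarrow> tfun \<Rightarrow> (real^2 \<Rightarrow> real^2) \<Rightarrow> 2 \<Rightarrow> tfun \<Rightarrow> tfun" where
  "d_op F \<theta> \<kappa> n f x y =
     pdx f n x y + (\<Sum>k\<in>UNIV. Ncoef F \<theta> \<kappa> k n x y * pdy f k x y)"

end

theory Submission
  imports Defs
begin

text \<open>
  Write \<open>F_i, \<theta>_i\<close> for fibre derivatives, and \<open>F_;n, \<theta>_;n\<close> for derivatives along the base.
  In each fibre \<open>(F, \<theta>)\<close> is a polar coordinate system: the covectors \<open>l_i = F_i\<close> and
  \<open>m_i = F \<theta>_i\<close> form a frame with dual frame \<open>l^i, m^i\<close> (lemma \<open>m_up_pairings\<close>; Euler's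
  relations supply the pairings with \<open>l^i\<close>). Consequently \<open>N^k_n\<close> is the unique solution of the
  linear system
    \<open>F_k N^k_n = - F_;n\<close>,  \<open>\<theta>_k N^k_n = \<kappa>_n - \<theta>_;n\<close>
  (lemmas \<open>Ncoef_F\<close> and \<open>Ncoef_\<theta>\<close>), which is exactly the pair of assertions
  \<open>d_n F = 0\<close>, \<open>d_n \<theta> = \<kappa>_n\<close>.

  The third assertion comes from differentiating this system in the fibre, twice for the first
  equation and once for the second. Everything that appears can be expressed through first
  derivatives by two identities, both consequences of homogeneity in dimension two:
    \<open>F_ij = F \<theta>_i \<theta>_j\<close>  (lemma \<open>angular_metric\<close>),
    \<open>F \<theta>_ij = J \<theta>_i \<theta>_j - F_i \<theta>_j - F_j \<theta>_i\<close>  for some scalar \<open>J\<close>  (lemma \<open>hessian_\<theta>\<close>).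
  Homogeneity puts \<open>y\<close> into the kernel of the symmetric forms \<open>F_ij\<close> and
  \<open>F \<theta>_ij + F_i \<theta>_j + F_j \<theta>_i\<close>, and on a plane such a form must be a multiple of
  \<open>\<theta>_i \<theta>_j\<close>, since \<open>\<theta>_i\<close> spans the annihilator of \<open>y\<close>
  (lemma \<open>symmetric_kernel_rank_one\<close>). Interchanging base and fibre derivatives and replacing
  \<open>F_mi;n\<close> by the base derivative of \<open>F \<theta>_m \<theta>_i\<close>, all mixed derivatives
  \<open>\<theta>_m;n\<close> cancel, and then so do the terms in \<open>J\<close>, leaving \<open>F_k N^k_nmi = 0\<close>
  (lemma \<open>y_low_Ncoef2\<close>).

  The analytic input is that functions of class \<open>C^r\<close> are closed under arithmetic, that
  partial derivatives commute (lemma \<open>second_derivative_symmetric\<close>), and that \<open>N^k_n\<close> is of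
  class \<open>C^2\<close> (lemma \<open>C_on_Ncoef\<close>), which Cramer's rule for the system above gives.
\<close>

section \<open>Functions of class C^r\<close>

lemma frechet_derivative_eq: "(f has_derivative D) (at p) \<Longrightarrow> frechet_derivative f (at p) = D"
  by (simp add: frechet_derivative_at[symmetric])

lemma frechet_derivative_cong_open:
  assumes "open S" "p \<in> S" "\<And>q. q \<in> S \<Longrightarrow> f q = g q"
  shows "frechet_derivative f (at p) = frechet_derivative g (at p)"
proof -
  have "(f has_derivative D) (at p) \<longleftrightarrow> (g has_derivative D) (at p)" for D
    using has_derivative_transform_within_open[of f D p UNIV S g]
      has_derivative_transform_within_open[of g D p UNIV S f] assms by auto
  then show ?thesis by (simp add: frechet_derivative_def)
qed

lemma differentiable_cong_open:
  assumes "open S" "p \<in> S" "\<And>q. q \<in> S \<Longrightarrow> f q = g q" "f differentiable (at p)"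
  shows "g differentiable (at p)"
  using assms has_derivative_transform_within_open[of f _ p UNIV S g]
  unfolding differentiable_def by blast

lemma C_on_cong:
  assumes "open S" "\<And>q. q \<in> S \<Longrightarrow> f q = g q" "C_on r S f"
  shows "C_on r S g"
  using assms(2,3)
proof (induction r arbitrary: f g)
  case 0
  then show ?case by (auto cong: continuous_on_cong)
next
  case (Suc r)
  note C = C_on.simps(2)[THEN iffD1, OF Suc.prems(2)]
  have "C_on r S (\<lambda>p. frechet_derivative g (at p) v)" for v
  proof (rule Suc.IH[OF _ C[THEN conjunct2, rule_format]])
    fix q assume "q \<in> S"
    from frechet_derivative_cong_open[OF assms(1) this Suc.prems(1)]
    show "frechet_derivative f (at q) v = frechet_derivative g (at q) v" by simp
  qed
  moreover have "\<forall>p\<in>S. g differentiable (at p)"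
  proof
    fix p assume "p \<in> S"
    then show "g differentiable (at p)"
      using differentiable_cong_open[OF assms(1), of p f g] Suc.prems(1) C by simp
  qed
  ultimately show ?case by simp
qed

text \<open>
  The explicit derivative \<open>D\<close> replaces \<open>frechet_derivative\<close> in the closure proofs below; the two
  agree only on \<open>S\<close>, so openness of \<open>S\<close> enters through \<open>C_on_cong\<close>.
\<close>

lemma C_on_SucI:
  assumes "open S" and D: "\<And>p. p \<in> S \<Longrightarrow> (f has_derivative D p) (at p)"
    and "\<And>v. C_on r S (\<lambda>p. D p v)"
  shows "C_on (Suc r) S f"
proof -
  have "C_on r S (\<lambda>p. frechet_derivative f (at p) v)" for v
    by (rule C_on_cong[OF assms(1) _ assms(3)[of v]]) (simp add: frechet_derivative_eq[OF D])
  moreover have "\<forall>p\<in>S. f differentiable (at p)"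
    using D unfolding differentiable_def by blast
  ultimately show ?thesis by simp
qed

lemma C_on_SucD: "C_on (Suc r) S f \<Longrightarrow> C_on r S f"
proof (induction r arbitrary: f)
  case 0
  then have "\<forall>p\<in>S. f differentiable (at p)" by simp
  then have "continuous_on S f"
    by (intro continuous_at_imp_continuous_on ballI differentiable_imp_continuous_within) blast
  then show ?case by simp
next
  case (Suc r)
  note * = C_on.simps(2)[THEN iffD1, OF Suc.prems]
  show ?case
    unfolding C_on.simps(2)[of r]
    by (intro conjI allI Suc.IH *[THEN conjunct1] *[THEN conjunct2, rule_format])
qed

lemma C_on_mono: "C_on r S f \<Longrightarrow> s \<le> r \<Longrightarrow> C_on s S f"
proof (induction r)
  case (Suc r)
  show ?case
  proof (cases "s = Suc r")
    case True
    then show ?thesis using Suc.prems(1) by (simp only:)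
  next
    case False
    then have "s \<le> r" using Suc.prems(2) by linarith
    then show ?thesis by (rule Suc.IH[OF C_on_SucD[OF Suc.prems(1)]])
  qed
qed simp

lemma C_on_differentiable: "C_on r S f \<Longrightarrow> r \<noteq> 0 \<Longrightarrow> p \<in> S \<Longrightarrow> f differentiable (at p)"
  by (cases r) auto

lemma C_on_bounded_linear_left:
  assumes h: "bounded_linear h"
  shows "open S \<Longrightarrow> C_on r S f \<Longrightarrow> C_on r S (\<lambda>p. h (f p))"
proof (induction r arbitrary: f)
  case 0
  then show ?case using bounded_linear.continuous_on[OF h] by auto
next
  case (Suc r)
  have D: "((\<lambda>p. h (f p)) has_derivative (\<lambda>v. h (frechet_derivative f (at p) v))) (at p)"
    if "p \<in> S" for p
    using Suc.prems that
    by (intro bounded_linear.has_derivative[OF h]) (simp flip: frechet_derivative_works)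
  have "C_on r S (\<lambda>p. h (frechet_derivative f (at p) v))" for v
    using Suc.prems by (intro Suc.IH) simp_all
  then show ?case
    using C_on_SucI[OF Suc.prems(1) D] by blast
qed

lemma C_on_compose_linear:
  assumes h: "bounded_linear h" and "open S" "open T" "h ` S \<subseteq> T"
  shows "C_on r T f \<Longrightarrow> C_on r S (\<lambda>p. f (h p))"
proof (induction r arbitrary: f)
  case 0
  then show ?case
    using assms by (auto intro!: continuous_on_compose2[of T f S h] linear_continuous_on[OF h])
next
  case (Suc r)
  have D: "((\<lambda>p. f (h p)) has_derivative (\<lambda>v. frechet_derivative f (at (h p)) (h v))) (at p)"
    if "p \<in> S" for p
    by (rule has_derivative_compose[OF bounded_linear_imp_has_derivative[OF h]])
      (use Suc.prems that assms(4) in \<open>auto simp flip: frechet_derivative_works\<close>)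
  have "C_on r S (\<lambda>p. frechet_derivative f (at (h p)) (h v))" for v
    using Suc.prems by (intro Suc.IH) simp
  then show ?case
    using C_on_SucI[OF assms(2) D] by blast
qed

lemma C_on_add:
  "open S \<Longrightarrow> C_on r S f \<Longrightarrow> C_on r S g \<Longrightarrow> C_on r S (\<lambda>p. f p + g p)"
proof (induction r arbitrary: f g)
  case 0
  then show ?case by (auto intro: continuous_on_add)
next
  case (Suc r)
  have D: "((\<lambda>p. f p + g p) has_derivative
      (\<lambda>v. frechet_derivative f (at p) v + frechet_derivative g (at p) v)) (at p)" if "p \<in> S" for p
    using Suc.prems that by (intro has_derivative_add) (auto simp flip: frechet_derivative_works)
  have "C_on r S (\<lambda>p. frechet_derivative f (at p) v + frechet_derivative g (at p) v)" for v
    using Suc.prems by (intro Suc.IH) simp_all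
  then show ?case
    using C_on_SucI[OF Suc.prems(1) D] by blast
qed

lemma C_on_minus: "open S \<Longrightarrow> C_on r S f \<Longrightarrow> C_on r S (\<lambda>p. - f p)"
  using C_on_bounded_linear_left[OF bounded_linear_minus[OF bounded_linear_ident]] by fast

lemma C_on_diff:
  "open S \<Longrightarrow> C_on r S f \<Longrightarrow> C_on r S g \<Longrightarrow> C_on r S (\<lambda>p. f p - g p)"
  using C_on_add[of S r f "\<lambda>p. - g p"] C_on_minus[of S r g] by simp

lemma C_on_mult:
  fixes f g :: "'a::euclidean_space \<Rightarrow> real"
  shows "open S \<Longrightarrow> C_on r S f \<Longrightarrow> C_on r S g \<Longrightarrow> C_on r S (\<lambda>p. f p * g p)"
proof (induction r arbitrary: f g)
  case 0
  then show ?case by (auto intro: continuous_on_mult)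
next
  case (Suc r)
  have D: "((\<lambda>p. f p * g p) has_derivative
      (\<lambda>v. f p * frechet_derivative g (at p) v + frechet_derivative f (at p) v * g p)) (at p)"
    if "p \<in> S" for p
    using Suc.prems that by (intro has_derivative_mult) (auto simp flip: frechet_derivative_works)
  have "C_on r S f" "C_on r S g" using Suc.prems C_on_SucD by blast+
  then have "C_on r S (\<lambda>p. f p * frechet_derivative g (at p) v + frechet_derivative f (at p) v * g p)" for v
    using Suc.prems by (intro C_on_add Suc.IH) simp_all
  then show ?case
    using C_on_SucI[OF Suc.prems(1) D] by blast
qed

lemma C_on_inverse:
  fixes f :: "'a::euclidean_space \<Rightarrow> real"
  assumes "open S" "\<And>p. p \<in> S \<Longrightarrow> f p \<noteq> 0"
  shows "C_on r S f \<Longrightarrow> C_on r S (\<lambda>p. inverse (f p))"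
proof (induction r)
  case 0
  then show ?case using assms by (auto intro: continuous_on_inverse)
next
  case (Suc r)
  have D: "((\<lambda>p. inverse (f p)) has_derivative
      (\<lambda>v. - (inverse (f p) * frechet_derivative f (at p) v * inverse (f p)))) (at p)"
    if "p \<in> S" for p
    using Suc.prems that assms(2)
    by (intro Deriv.has_derivative_inverse) (auto simp flip: frechet_derivative_works)
  have "C_on r S (\<lambda>p. inverse (f p))" using Suc C_on_SucD by blast
  then have "C_on r S (\<lambda>p. - (inverse (f p) * frechet_derivative f (at p) v * inverse (f p)))" for v
    using Suc.prems assms(1) by (intro C_on_minus C_on_mult) auto
  then show ?case
    using C_on_SucI[OF assms(1) D] by blast
qed

lemma C_on_divide:
  fixes f g :: "'a::euclidean_space \<Rightarrow> real"
  assumes "open S" "\<And>p. p \<in> S \<Longrightarrow> g p \<noteq> 0" "C_on r S f" "C_on r S g"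
  shows "C_on r S (\<lambda>p. f p / g p)"
  using assms C_on_mult[of S r f "\<lambda>p. inverse (g p)"] C_on_inverse[of S g r]
  by (simp add: divide_inverse)

section \<open>Symmetry of second derivatives\<close>

lemma has_real_derivative_along_line:
  fixes f :: "'a::real_normed_vector \<Rightarrow> real"
  assumes "f differentiable (at (p + s *\<^sub>R v))"
  shows "((\<lambda>t. f (p + t *\<^sub>R v)) has_real_derivative frechet_derivative f (at (p + s *\<^sub>R v)) v) (at s)"
proof -
  have lin: "bounded_linear (frechet_derivative f (at (p + s *\<^sub>R v)))"
    using assms by (simp add: frechet_derivative_works has_derivative_bounded_linear)
  have "((\<lambda>t. p + t *\<^sub>R v) has_derivative (\<lambda>t. t *\<^sub>R v)) (at s)"
    by (auto intro!: derivative_eq_intros)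
  from has_derivative_compose[OF this assms[unfolded frechet_derivative_works]]
  have "((\<lambda>t. f (p + t *\<^sub>R v)) has_derivative
      (\<lambda>t. frechet_derivative f (at (p + s *\<^sub>R v)) (t *\<^sub>R v))) (at s)" .
  then show ?thesis
    by (simp add: has_field_derivative_def linear_scale[OF bounded_linear.linear[OF lin]] mult.commute
        mult_commute_abs)
qed

text \<open>
  The second difference over a parallelogram is symmetric in \<open>u\<close> and \<open>v\<close>, while this expression
  for it, obtained by two applications of the mean value theorem, is an iterated derivative whose
  order depends on the roles of \<open>u\<close> and \<open>v\<close>. Comparing the two versions proves that second
  derivatives are symmetric.
\<close>

lemma second_difference_mean_value:
  fixes f :: "'a::euclidean_space \<Rightarrow> real"
  assumes C: "C_on 2 S f" and h: "0 < h"
    and S: "\<And>s t. 0 \<le> s \<Longrightarrow> s \<le> h \<Longrightarrow> 0 \<le> t \<Longrightarrow> t \<le> h \<Longrightarrow> p + s *\<^sub>R u + t *\<^sub>R v \<in> S"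
  obtains s t where "0 < s" "s < h" "0 < t" "t < h"
    "f (p + h *\<^sub>R u + h *\<^sub>R v) - f (p + h *\<^sub>R u) - f (p + h *\<^sub>R v) + f p =
      h * h * frechet_derivative (\<lambda>q. frechet_derivative f (at q) u) (at (p + s *\<^sub>R u + t *\<^sub>R v)) v"
proof -
  have d1: "f differentiable (at q)" and d2: "(\<lambda>q. frechet_derivative f (at q) u) differentiable (at q)"
    if "q \<in> S" for q
    using C that by (auto simp: numeral_2_eq_2)
  define \<phi> where "\<phi> s = f (p + h *\<^sub>R v + s *\<^sub>R u) - f (p + s *\<^sub>R u)" for s
  have \<phi>: "(\<phi> has_real_derivative frechet_derivative f (at (p + h *\<^sub>R v + s *\<^sub>R u)) u
      - frechet_derivative f (at (p + s *\<^sub>R u)) u) (at s)" if "0 \<le> s" "s \<le> h" for s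
    unfolding \<phi>_def
    by (intro DERIV_diff has_real_derivative_along_line d1)
      (use S[of s h] S[of s 0] that h in \<open>auto simp: add_ac\<close>)
  from MVT2[OF h \<phi>] obtain s where s: "0 < s" "s < h" and
    1: "\<phi> h - \<phi> 0 = (h - 0) * (frechet_derivative f (at (p + h *\<^sub>R v + s *\<^sub>R u)) u
      - frechet_derivative f (at (p + s *\<^sub>R u)) u)"
    by blast
  have "((\<lambda>t. frechet_derivative f (at (p + s *\<^sub>R u + t *\<^sub>R v)) u) has_real_derivative
      frechet_derivative (\<lambda>q. frechet_derivative f (at q) u) (at (p + s *\<^sub>R u + t *\<^sub>R v)) v) (at t)"
    if "0 \<le> t" "t \<le> h" for t
    by (intro has_real_derivative_along_line d2 S) (use that s in auto)
  from MVT2[OF h this] obtain t where t: "0 < t" "t < h" and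
    2: "frechet_derivative f (at (p + s *\<^sub>R u + h *\<^sub>R v)) u - frechet_derivative f (at (p + s *\<^sub>R u + 0 *\<^sub>R v)) u
      = (h - 0) * frechet_derivative (\<lambda>q. frechet_derivative f (at q) u) (at (p + s *\<^sub>R u + t *\<^sub>R v)) v"
    by blast
  have "f (p + h *\<^sub>R u + h *\<^sub>R v) - f (p + h *\<^sub>R u) - f (p + h *\<^sub>R v) + f p = \<phi> h - \<phi> 0"
    by (simp add: \<phi>_def add_ac)
  also have "\<dots> = h * h * frechet_derivative (\<lambda>q. frechet_derivative f (at q) u) (at (p + s *\<^sub>R u + t *\<^sub>R v)) v"
    using 1 2 by (simp add: add_ac)
  finally show ?thesis using that s t by blast
qed

text \<open>
  If the two iterated derivatives differed at \<open>p\<close>, by continuity they would differ on a whole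
  neighbourhood even when evaluated at two different points of it; a small parallelogram at \<open>p\<close>
  contains two points where they agree.
\<close>

lemma second_derivative_symmetric:
  fixes f :: "'a::euclidean_space \<Rightarrow> real"
  assumes S: "open S" and p: "p \<in> S" and C: "C_on 2 S f"
  shows "frechet_derivative (\<lambda>q. frechet_derivative f (at q) u) (at p) v =
    frechet_derivative (\<lambda>q. frechet_derivative f (at q) v) (at p) u" (is "?A p = ?B p")
proof (rule ccontr)
  assume ne: "?A p \<noteq> ?B p"
  define e where "e = dist (?A p) (?B p) / 2"
  have e: "e > 0" using ne by (simp add: e_def)
  have "continuous_on S ?A" "continuous_on S ?B"
    using C by (auto simp: numeral_2_eq_2)
  then have "isCont ?A p" "isCont ?B p"
    using S p continuous_on_eq_continuous_at by blast+
  note cont = this[unfolded continuous_at_eps_delta, rule_format, OF e]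
  obtain a where a: "a > 0" "\<And>q. dist q p < a \<Longrightarrow> dist (?A q) (?A p) < e"
    using cont(1) by blast
  obtain b where b: "b > 0" "\<And>q. dist q p < b \<Longrightarrow> dist (?B q) (?B p) < e"
    using cont(2) by blast
  obtain c where c: "c > 0" "ball p c \<subseteq> S" using S p openE by blast
  define r where "r = min a (min b c)"
  have r: "r > 0" "r \<le> a" "r \<le> b" "r \<le> c" using a b c by (auto simp: r_def)
  \<comment> \<open>The summand \<open>1\<close> keeps the denominator positive when \<open>u\<close> and \<open>v\<close> both vanish.\<close>
  define h where "h = (r / 2) / (norm u + norm v + 1)"
  have n: "norm u + norm v + 1 > 0" by (smt (verit) norm_ge_zero)
  have h: "h > 0" using r n by (simp add: h_def)
  have hr: "h * (norm u + norm v) < r"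
  proof -
    have "h * (norm u + norm v) \<le> h * (norm u + norm v + 1)" using h by simp
    also have "\<dots> = r / 2" using n by (intro nonzero_eq_divide_eq[THEN iffD1, OF _ h_def]) simp
    finally show ?thesis using r by simp
  qed
  have near: "dist (p + s *\<^sub>R u + t *\<^sub>R v) p < r" if "0 \<le> s" "s \<le> h" "0 \<le> t" "t \<le> h" for s t
  proof -
    have "dist (p + s *\<^sub>R u + t *\<^sub>R v) p \<le> s * norm u + t * norm v"
      using norm_triangle_ineq[of "s *\<^sub>R u" "t *\<^sub>R v"] that by (simp add: dist_norm add.assoc)
    also have "\<dots> \<le> h * norm u + h * norm v"
      using that by (intro add_mono mult_right_mono) auto
    finally show ?thesis using hr by (simp add: algebra_simps)
  qed
  have inS: "p + s *\<^sub>R u + t *\<^sub>R v \<in> S" if "0 \<le> s" "s \<le> h" "0 \<le> t" "t \<le> h" for s t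
    using near[OF that] r c by (auto simp: dist_commute subset_iff)
  obtain s t where st: "0 < s" "s < h" "0 < t" "t < h" and
    1: "f (p + h *\<^sub>R u + h *\<^sub>R v) - f (p + h *\<^sub>R u) - f (p + h *\<^sub>R v) + f p =
      h * h * ?A (p + s *\<^sub>R u + t *\<^sub>R v)"
    using second_difference_mean_value[OF C h, of p u v] inS by blast
  have inS': "p + s *\<^sub>R v + t *\<^sub>R u \<in> S" if "0 \<le> s" "s \<le> h" "0 \<le> t" "t \<le> h" for s t
    using inS[of t s] that by (simp add: add_ac)
  obtain s' t' where st': "0 < s'" "s' < h" "0 < t'" "t' < h" and
    2: "f (p + h *\<^sub>R v + h *\<^sub>R u) - f (p + h *\<^sub>R v) - f (p + h *\<^sub>R u) + f p =
      h * h * ?B (p + s' *\<^sub>R v + t' *\<^sub>R u)"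
    using second_difference_mean_value[OF C h, of p v u] inS' by blast
  have "p + h *\<^sub>R v + h *\<^sub>R u = p + h *\<^sub>R u + h *\<^sub>R v"
    by (simp add: add_ac)
  from 2[unfolded this] 1 have "h * h * ?A (p + s *\<^sub>R u + t *\<^sub>R v) = h * h * ?B (p + s' *\<^sub>R v + t' *\<^sub>R u)"
    by linarith
  then have eq: "?A (p + s *\<^sub>R u + t *\<^sub>R v) = ?B (p + t' *\<^sub>R u + s' *\<^sub>R v)"
    using h by (simp add: add_ac)
  have "dist (?A (p + s *\<^sub>R u + t *\<^sub>R v)) (?A p) < e"
    using near[of s t] st r by (intro a) auto
  moreover have "dist (?B (p + t' *\<^sub>R u + s' *\<^sub>R v)) (?B p) < e"
    using near[of t' s'] st' r by (intro b) auto
  ultimately have "dist (?A p) (?B p) < dist (?A p) (?B p)"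
    unfolding e_def eq by (rule dist_triangle_half_r)
  then show False by simp
qed

section \<open>Partial derivatives in base and fibre coordinates\<close>

abbreviation on_pairs :: "tfun \<Rightarrow> (real^2) \<times> (real^2) \<Rightarrow> real" where
  "on_pairs f \<equiv> \<lambda>p. f (fst p) (snd p)"

lemma has_derivative_pdx:
  assumes "on_pairs f differentiable (at (x, y))"
  shows "((\<lambda>t. f (x + t *\<^sub>R axis n 1) y) has_real_derivative pdx f n x y) (at 0)"
    and "pdx f n x y = frechet_derivative (on_pairs f) (at (x, y)) (axis n 1, 0)"
proof -
  have *: "((\<lambda>t. f (x + t *\<^sub>R axis n 1) y) has_real_derivative
      frechet_derivative (on_pairs f) (at (x, y)) (axis n 1, 0)) (at 0)"
    using has_real_derivative_along_line[of "on_pairs f" "(x, y)" 0 "(axis n 1, 0)"] assms by simp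
  then show "pdx f n x y = frechet_derivative (on_pairs f) (at (x, y)) (axis n 1, 0)"
    by (simp add: pdx_def DERIV_imp_deriv)
  with * show "((\<lambda>t. f (x + t *\<^sub>R axis n 1) y) has_real_derivative pdx f n x y) (at 0)"
    by simp
qed

lemma has_derivative_pdy:
  assumes "on_pairs f differentiable (at (x, y))"
  shows "((\<lambda>t. f x (y + t *\<^sub>R axis n 1)) has_real_derivative pdy f n x y) (at 0)"
    and "pdy f n x y = frechet_derivative (on_pairs f) (at (x, y)) (0, axis n 1)"
proof -
  have *: "((\<lambda>t. f x (y + t *\<^sub>R axis n 1)) has_real_derivative
      frechet_derivative (on_pairs f) (at (x, y)) (0, axis n 1)) (at 0)"
    using has_real_derivative_along_line[of "on_pairs f" "(x, y)" 0 "(0, axis n 1)"] assms by simp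
  then show "pdy f n x y = frechet_derivative (on_pairs f) (at (x, y)) (0, axis n 1)"
    by (simp add: pdy_def DERIV_imp_deriv)
  with * show "((\<lambda>t. f x (y + t *\<^sub>R axis n 1)) has_real_derivative pdy f n x y) (at 0)"
    by simp
qed

lemma C_on_pdx:
  assumes "open \<Omega>" "C_on (Suc r) \<Omega> (on_pairs f)"
  shows "C_on r \<Omega> (on_pairs (pdx f n))"
proof (rule C_on_cong[OF assms(1)])
  show "C_on r \<Omega> (\<lambda>p. frechet_derivative (on_pairs f) (at p) (axis n 1, 0))"
    using assms(2) by simp
qed (use assms(2) in \<open>auto simp: has_derivative_pdx(2)\<close>)

lemma C_on_pdy:
  assumes "open \<Omega>" "C_on (Suc r) \<Omega> (on_pairs f)"
  shows "C_on r \<Omega> (on_pairs (pdy f n))"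
proof (rule C_on_cong[OF assms(1)])
  show "C_on r \<Omega> (\<lambda>p. frechet_derivative (on_pairs f) (at p) (0, axis n 1))"
    using assms(2) by simp
qed (use assms(2) in \<open>auto simp: has_derivative_pdy(2)\<close>)

lemma pdx_cong:
  assumes "open \<Omega>" "(x, y) \<in> \<Omega>" "\<And>x y. (x, y) \<in> \<Omega> \<Longrightarrow> f x y = g x y"
  shows "pdx f n x y = pdx g n x y"
proof -
  have "((\<lambda>t. (x + t *\<^sub>R axis n 1, y)) \<longlongrightarrow> (x + 0 *\<^sub>R axis n 1, y)) (nhds (0::real))"
    by (intro tendsto_intros filterlim_ident)
  then have "eventually (\<lambda>t. (x + t *\<^sub>R axis n 1, y) \<in> \<Omega>) (nhds (0::real))"
    by (rule topological_tendstoD) (use assms in auto)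
  then have "eventually (\<lambda>t. f (x + t *\<^sub>R axis n 1) y = g (x + t *\<^sub>R axis n 1) y) (nhds (0::real))"
    by eventually_elim (rule assms(3))
  then show ?thesis unfolding pdx_def by (rule deriv_cong_ev) simp
qed

lemma pdy_cong:
  assumes "open \<Omega>" "(x, y) \<in> \<Omega>" "\<And>x y. (x, y) \<in> \<Omega> \<Longrightarrow> f x y = g x y"
  shows "pdy f n x y = pdy g n x y"
proof -
  have "((\<lambda>t. (x, y + t *\<^sub>R axis n 1)) \<longlongrightarrow> (x, y + 0 *\<^sub>R axis n 1)) (nhds (0::real))"
    by (intro tendsto_intros filterlim_ident)
  then have "eventually (\<lambda>t. (x, y + t *\<^sub>R axis n 1) \<in> \<Omega>) (nhds (0::real))"
    by (rule topological_tendstoD) (use assms in auto)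
  then have "eventually (\<lambda>t. f x (y + t *\<^sub>R axis n 1) = g x (y + t *\<^sub>R axis n 1)) (nhds (0::real))"
    by eventually_elim (rule assms(3))
  then show ?thesis unfolding pdy_def by (rule deriv_cong_ev) simp
qed

text \<open>
  Both sides are second derivatives of \<open>on_pairs f\<close> in the directions \<open>(axis n 1, 0)\<close> and
  \<open>(0, axis m 1)\<close>.
\<close>

lemma pdy_pdx_commute:
  assumes "open \<Omega>" "(x, y) \<in> \<Omega>" "C_on 2 \<Omega> (on_pairs f)"
  shows "pdy (pdx f n) m x y = pdx (pdy f m) n x y"
proof -
  have C1: "C_on (Suc 1) \<Omega> (on_pairs f)" using assms(3) by (simp add: numeral_2_eq_2)
  have d: "on_pairs f differentiable (at q)" if "q \<in> \<Omega>" for q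
    using C_on_differentiable[OF assms(3)] that by simp
  have "on_pairs (pdx f n) differentiable (at (x, y))" "on_pairs (pdy f m) differentiable (at (x, y))"
    using C_on_differentiable[OF C_on_pdx[OF assms(1) C1]] C_on_differentiable[OF C_on_pdy[OF assms(1) C1]]
      assms(2) by auto
  then have "pdy (pdx f n) m x y = frechet_derivative (on_pairs (pdx f n)) (at (x, y)) (0, axis m 1)"
    and 2: "pdx (pdy f m) n x y = frechet_derivative (on_pairs (pdy f m)) (at (x, y)) (axis n 1, 0)"
    by (simp_all only: has_derivative_pdy(2) has_derivative_pdx(2))
  note this(1)
  also have "frechet_derivative (on_pairs (pdx f n)) (at (x, y)) =
      frechet_derivative (\<lambda>q. frechet_derivative (on_pairs f) (at q) (axis n 1, 0)) (at (x, y))"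
    by (rule frechet_derivative_cong_open[OF assms(1,2)]) (use d has_derivative_pdx(2) in auto)
  also have "frechet_derivative (\<lambda>q. frechet_derivative (on_pairs f) (at q) (axis n 1, 0)) (at (x, y)) (0, axis m 1)
    = frechet_derivative (\<lambda>q. frechet_derivative (on_pairs f) (at q) (0, axis m 1)) (at (x, y)) (axis n 1, 0)"
    by (rule second_derivative_symmetric[OF assms])
  also have "frechet_derivative (\<lambda>q. frechet_derivative (on_pairs f) (at q) (0, axis m 1)) (at (x, y)) =
      frechet_derivative (on_pairs (pdy f m)) (at (x, y))"
    by (rule frechet_derivative_cong_open[OF assms(1,2)]) (use d has_derivative_pdy(2) in auto)
  finally show ?thesis by (simp only: 2)
qed

lemma pdy_pdy_commute:
  assumes "open \<Omega>" "(x, y) \<in> \<Omega>" "C_on 2 \<Omega> (on_pairs f)"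
  shows "pdy (pdy f n) m x y = pdy (pdy f m) n x y"
proof -
  have C1: "C_on (Suc 1) \<Omega> (on_pairs f)" using assms(3) by (simp add: numeral_2_eq_2)
  have d: "on_pairs f differentiable (at q)" if "q \<in> \<Omega>" for q
    using C_on_differentiable[OF assms(3)] that by simp
  have *: "pdy (pdy f n) m x y = frechet_derivative
      (\<lambda>q. frechet_derivative (on_pairs f) (at q) (0, axis n 1)) (at (x, y)) (0, axis m 1)" for n m
  proof -
    have "on_pairs (pdy f n) differentiable (at (x, y))"
      using C_on_differentiable[OF C_on_pdy[OF assms(1) C1]] assms(2) by auto
    then have "pdy (pdy f n) m x y = frechet_derivative (on_pairs (pdy f n)) (at (x, y)) (0, axis m 1)"
      by (rule has_derivative_pdy(2))
    also have "frechet_derivative (on_pairs (pdy f n)) (at (x, y)) =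
        frechet_derivative (\<lambda>q. frechet_derivative (on_pairs f) (at q) (0, axis n 1)) (at (x, y))"
      by (rule frechet_derivative_cong_open[OF assms(1,2)]) (use d has_derivative_pdy(2) in auto)
    finally show ?thesis .
  qed
  show ?thesis unfolding * by (rule second_derivative_symmetric[OF assms])
qed

lemma pdy_add:
  assumes "on_pairs f differentiable (at (x, y))" "on_pairs g differentiable (at (x, y))"
  shows "pdy (\<lambda>x y. f x y + g x y) m x y = pdy f m x y + pdy g m x y"
  unfolding pdy_def[of "\<lambda>x y. f x y + g x y"]
  by (rule DERIV_imp_deriv[OF DERIV_add[OF has_derivative_pdy(1)[OF assms(1)] has_derivative_pdy(1)[OF assms(2)]]])

lemma pdy_diff:
  assumes "on_pairs f differentiable (at (x, y))" "on_pairs g differentiable (at (x, y))"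
  shows "pdy (\<lambda>x y. f x y - g x y) m x y = pdy f m x y - pdy g m x y"
  unfolding pdy_def[of "\<lambda>x y. f x y - g x y"]
  by (rule DERIV_imp_deriv[OF DERIV_diff[OF has_derivative_pdy(1)[OF assms(1)] has_derivative_pdy(1)[OF assms(2)]]])

lemma pdy_minus:
  assumes "on_pairs f differentiable (at (x, y))"
  shows "pdy (\<lambda>x y. - f x y) m x y = - pdy f m x y"
  unfolding pdy_def[of "\<lambda>x y. - f x y"]
  by (rule DERIV_imp_deriv[OF DERIV_minus[OF has_derivative_pdy(1)[OF assms(1)]]])

lemma pdy_mult:
  assumes "on_pairs f differentiable (at (x, y))" "on_pairs g differentiable (at (x, y))"
  shows "pdy (\<lambda>x y. f x y * g x y) m x y = pdy f m x y * g x y + f x y * pdy g m x y"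
  unfolding pdy_def[of "\<lambda>x y. f x y * g x y"]
  using DERIV_imp_deriv[OF DERIV_mult[OF has_derivative_pdy(1)[OF assms(1)] has_derivative_pdy(1)[OF assms(2)]], of m m]
  by (simp add: mult.commute)

lemma pdy_pairing:
  assumes "on_pairs f1 differentiable (at (x, y))" "on_pairs f2 differentiable (at (x, y))"
    "on_pairs g1 differentiable (at (x, y))" "on_pairs g2 differentiable (at (x, y))"
  shows "pdy (\<lambda>x y. f1 x y * g1 x y + f2 x y * g2 x y) m x y =
    (pdy f1 m x y * g1 x y + pdy f2 m x y * g2 x y) + (f1 x y * pdy g1 m x y + f2 x y * pdy g2 m x y)"
proof -
  have "pdy (\<lambda>x y. f1 x y * g1 x y + f2 x y * g2 x y) m x y =
      pdy (\<lambda>x y. f1 x y * g1 x y) m x y + pdy (\<lambda>x y. f2 x y * g2 x y) m x y"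
    using assms by (intro pdy_add differentiable_mult)
  then show ?thesis by (simp add: pdy_mult assms)
qed

lemma pdx_mult:
  assumes "on_pairs f differentiable (at (x, y))" "on_pairs g differentiable (at (x, y))"
  shows "pdx (\<lambda>x y. f x y * g x y) m x y = pdx f m x y * g x y + f x y * pdx g m x y"
  unfolding pdx_def[of "\<lambda>x y. f x y * g x y"]
  using DERIV_imp_deriv[OF DERIV_mult[OF has_derivative_pdx(1)[OF assms(1)] has_derivative_pdx(1)[OF assms(2)]], of m m]
  by (simp add: mult.commute)

lemma pdy_component: "pdy (\<lambda>x y. y $ k) m x y = (if k = m then 1 else 0)"
proof -
  have "((\<lambda>t. (y + t *\<^sub>R axis m 1) $ k) has_real_derivative axis m 1 $ k) (at 0)"
    by (auto intro!: derivative_eq_intros)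
  then show ?thesis unfolding pdy_def by (auto dest!: DERIV_imp_deriv simp: axis_def)
qed

lemma pdy_base: "pdy (\<lambda>x y. c x) m x y = 0"
  by (simp add: pdy_def)

lemma differentiable_component: "on_pairs (\<lambda>x y. y $ k) differentiable (at p)"
  by (intro bounded_linear_imp_differentiable bounded_linear_compose[OF bounded_linear_vec_nth bounded_linear_snd])

text \<open>
  Differentiate \<open>t \<mapsto> f x ((1 + t) y)\<close> at \<open>t = 0\<close>.
\<close>

lemma euler_homogeneous:
  assumes diff: "on_pairs f differentiable (at (x, y))"
    and hom: "\<And>t. t > 0 \<Longrightarrow> f x (t *\<^sub>R y) = t ^ d * f x y"
  shows "y $ 1 * pdy f 1 x y + y $ 2 * pdy f 2 x y = of_nat d * f x y"
proof -
  let ?D = "frechet_derivative (on_pairs f) (at (x, y))"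
  have lin: "linear ?D"
    using diff by (simp add: frechet_derivative_works has_derivative_linear)
  have "((\<lambda>t. f x (y + t *\<^sub>R y)) has_real_derivative ?D (0, y)) (at 0)"
    using has_real_derivative_along_line[of "on_pairs f" "(x, y)" 0 "(0, y)"] diff by simp
  moreover have "((\<lambda>t. f x (y + t *\<^sub>R y)) has_real_derivative of_nat d * f x y) (at 0)"
  proof (rule DERIV_cong_ev[THEN iffD1])
    have "eventually (\<lambda>t. t > (-1::real)) (nhds 0)"
      by (rule order_tendstoD(1)[OF filterlim_ident]) simp
    then show "eventually (\<lambda>t. (1 + t) ^ d * f x y = f x (y + t *\<^sub>R y)) (nhds 0)"
    proof eventually_elim
      case (elim t)
      then show ?case using hom[of "1 + t"] by (simp add: scaleR_add_left)
    qed
    show "((\<lambda>t. (1 + t) ^ d * f x y) has_real_derivative of_nat d * f x y) (at 0)"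
      by (auto intro!: derivative_eq_intros)
  qed auto
  ultimately have "of_nat d * f x y = ?D (0, y)" by (rule DERIV_unique[OF _, symmetric])
  also have "(0, y) = (y $ 1) *\<^sub>R (0::real^2, axis 1 1) + (y $ 2) *\<^sub>R (0::real^2, axis 2 1)"
    by (simp add: vec_eq_iff forall_2 axis_def)
  also have "?D \<dots> = y $ 1 * ?D (0, axis 1 1) + y $ 2 * ?D (0, axis 2 1)"
    by (simp only: linear_add[OF lin] linear_scale[OF lin] real_scaleR_def)
  finally show ?thesis using has_derivative_pdy(2)[OF diff] by simp
qed

section \<open>The frame defined by the metric function and the angle function\<close>

text \<open>
  This is where dimension two enters: the annihilator of \<open>y\<close> is a line, spanned by \<open>\<tau>\<close>, and a
  symmetric form with \<open>y\<close> in its kernel is a quadratic form on the quotient by \<open>y\<close>.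
\<close>

lemma symmetric_kernel_rank_one:
  fixes S :: "2 \<Rightarrow> 2 \<Rightarrow> real" and y \<tau> :: "2 \<Rightarrow> real"
  assumes sym: "S 1 2 = S 2 1"
    and S1: "S 1 1 * y 1 + S 1 2 * y 2 = 0" and S2: "S 2 1 * y 1 + S 2 2 * y 2 = 0"
    and \<tau>y: "y 1 * \<tau> 1 + y 2 * \<tau> 2 = 0"
    and y: "y 1 \<noteq> 0 \<or> y 2 \<noteq> 0" and \<tau>: "\<tau> 1 \<noteq> 0 \<or> \<tau> 2 \<noteq> 0"
  shows "\<exists>J. \<forall>i j. S i j = J * \<tau> i * \<tau> j"
proof -
  define T where "T = \<tau> 1 * \<tau> 1 + \<tau> 2 * \<tau> 2"
  have T: "T \<noteq> 0" using \<tau> by (auto simp: T_def sum_squares_eq_zero_iff)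
  \<comment> \<open>The rows of \<open>S\<close> and \<open>\<tau>\<close> are all orthogonal to \<open>y\<close>, hence parallel.\<close>
  have p1: "S 1 1 * \<tau> 2 = S 1 2 * \<tau> 1" and p2: "S 2 1 * \<tau> 2 = S 2 2 * \<tau> 1"
    using S1 S2 \<tau>y y by algebra+
  have "S 1 1 * T = (S 1 1 + S 2 2) * \<tau> 1 * \<tau> 1" "S 1 2 * T = (S 1 1 + S 2 2) * \<tau> 1 * \<tau> 2"
    "S 2 2 * T = (S 1 1 + S 2 2) * \<tau> 2 * \<tau> 2"
    unfolding T_def using p1 p2 sym by algebra+
  then have "S i j = (S 1 1 + S 2 2) / T * \<tau> i * \<tau> j" for i j
    using T sym exhaust_2[of i] exhaust_2[of j] by (auto simp: field_simps)
  then show ?thesis by blast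
qed

locale finsler_surface =
  fixes \<Omega> :: "((real^2) \<times> (real^2)) set" and F \<theta> :: tfun
  assumes open_\<Omega>: "open \<Omega>"
    and nonzero: "(x, y) \<in> \<Omega> \<Longrightarrow> y \<noteq> 0"
    and metric: "finsler_metric_on \<Omega> F"
    and angle: "angle_function_on \<Omega> F \<theta>"
begin

lemma C_F: "C_on 4 \<Omega> (on_pairs F)"
  and F_pos: "(x, y) \<in> \<Omega> \<Longrightarrow> F x y > 0"
  and F_hom: "(x, y) \<in> \<Omega> \<Longrightarrow> t > 0 \<Longrightarrow> F x (t *\<^sub>R y) = t * F x y"
  and g_posdef: "(x, y) \<in> \<Omega> \<Longrightarrow> v \<noteq> 0 \<Longrightarrow>
    (\<Sum>i\<in>UNIV. \<Sum>j\<in>UNIV. g_low F x y $ i $ j * v $ i * v $ j) > 0"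
  using metric unfolding finsler_metric_on_def by blast+

lemma C_\<theta>: "C_on 3 \<Omega> (on_pairs \<theta>)"
  and \<theta>_hom: "(x, y) \<in> \<Omega> \<Longrightarrow> t > 0 \<Longrightarrow> \<theta> x (t *\<^sub>R y) = \<theta> x y"
  and angle_eq: "(x, y) \<in> \<Omega> \<Longrightarrow> F x y * pdy \<theta> n x y = m_low F n x y"
  using angle unfolding angle_function_on_def by blast+

lemma C_Fy: "C_on 3 \<Omega> (on_pairs (pdy F k))"
  and C_Fx: "C_on 3 \<Omega> (on_pairs (pdx F k))"
  by (rule C_on_pdy[OF open_\<Omega> C_on_mono[OF C_F]], simp)
    (rule C_on_pdx[OF open_\<Omega> C_on_mono[OF C_F]], simp)

lemma C_\<theta>y: "C_on 2 \<Omega> (on_pairs (pdy \<theta> k))"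
  and C_\<theta>x: "C_on 2 \<Omega> (on_pairs (pdx \<theta> k))"
  by (rule C_on_pdy[OF open_\<Omega> C_on_mono[OF C_\<theta>]], simp)
    (rule C_on_pdx[OF open_\<Omega> C_on_mono[OF C_\<theta>]], simp)

lemmas diff_rules = C_F[THEN C_on_differentiable] C_\<theta>[THEN C_on_differentiable]
  C_Fy[THEN C_on_differentiable] C_Fx[THEN C_on_differentiable] C_\<theta>y[THEN C_on_differentiable]
  C_\<theta>x[THEN C_on_differentiable]

lemma euler_F: "(x, y) \<in> \<Omega> \<Longrightarrow> y $ 1 * pdy F 1 x y + y $ 2 * pdy F 2 x y = F x y"
  using euler_homogeneous[of F x y 1] F_hom by (simp add: diff_rules)

lemma euler_\<theta>: "(x, y) \<in> \<Omega> \<Longrightarrow> y $ 1 * pdy \<theta> 1 x y + y $ 2 * pdy \<theta> 2 x y = 0"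
  using euler_homogeneous[of \<theta> x y 0] \<theta>_hom by (simp add: diff_rules)

text \<open>
  For differentiating Euler's relations of \<open>F\<close> and \<open>\<theta>\<close>.
\<close>

lemma pdy_euler:
  assumes "on_pairs (pdy f 1) differentiable (at (x, y))" "on_pairs (pdy f 2) differentiable (at (x, y))"
  shows "pdy (\<lambda>x y. y $ 1 * pdy f 1 x y + y $ 2 * pdy f 2 x y) m x y =
    pdy f m x y + y $ 1 * pdy (pdy f 1) m x y + y $ 2 * pdy (pdy f 2) m x y"
proof -
  have "pdy (\<lambda>x y. y $ 1 * pdy f 1 x y + y $ 2 * pdy f 2 x y) m x y =
      pdy (\<lambda>x y. y $ 1 * pdy f 1 x y) m x y + pdy (\<lambda>x y. y $ 2 * pdy f 2 x y) m x y"
    using assms by (intro pdy_add differentiable_mult differentiable_component)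
  also have "\<dots> = pdy f m x y + y $ 1 * pdy (pdy f 1) m x y + y $ 2 * pdy (pdy f 2) m x y"
    using exhaust_2[of m] by (auto simp: pdy_mult assms differentiable_component pdy_component)
  finally show ?thesis .
qed

lemma pdy_F_symmetric: "(x, y) \<in> \<Omega> \<Longrightarrow> pdy (pdy F i) j x y = pdy (pdy F j) i x y"
  by (rule pdy_pdy_commute[OF open_\<Omega> _ C_on_mono[OF C_F]]) simp_all

lemma pdy_\<theta>_symmetric: "(x, y) \<in> \<Omega> \<Longrightarrow> pdy (pdy \<theta> i) j x y = pdy (pdy \<theta> j) i x y"
  by (rule pdy_pdy_commute[OF open_\<Omega> _ C_on_mono[OF C_\<theta>]]) simp_all

lemma hessian_F_kernel:
  assumes "(x, y) \<in> \<Omega>"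
  shows "pdy (pdy F m) 1 x y * y $ 1 + pdy (pdy F m) 2 x y * y $ 2 = 0"
proof -
  have "pdy (\<lambda>x y. y $ 1 * pdy F 1 x y + y $ 2 * pdy F 2 x y) m x y = pdy F m x y"
    by (rule pdy_cong[OF open_\<Omega> assms euler_F])
  then show ?thesis
    using assms by (simp add: pdy_euler diff_rules pdy_F_symmetric[of x y m] mult.commute)
qed

lemma hessian_\<theta>_euler:
  assumes "(x, y) \<in> \<Omega>"
  shows "pdy (pdy \<theta> m) 1 x y * y $ 1 + pdy (pdy \<theta> m) 2 x y * y $ 2 = - pdy \<theta> m x y"
proof -
  have "pdy (\<lambda>x y. y $ 1 * pdy \<theta> 1 x y + y $ 2 * pdy \<theta> 2 x y) m x y = pdy (\<lambda>x y. 0) m x y"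
    by (rule pdy_cong[OF open_\<Omega> assms euler_\<theta>])
  then show ?thesis
    using assms by (simp add: pdy_euler pdy_base diff_rules pdy_\<theta>_symmetric[of x y m] mult.commute)
qed

lemma g_low_hessian:
  assumes "(x, y) \<in> \<Omega>"
  shows "g_low F x y $ i $ j = pdy F i x y * pdy F j x y + F x y * pdy (pdy F i) j x y"
proof -
  have "y_low F i = (\<lambda>x y. F x y * pdy F i x y)" by (simp add: y_low_def fun_eq_iff)
  then show ?thesis using assms by (simp add: g_low_def pdy_mult diff_rules mult.commute)
qed

lemma det_g_pos:
  assumes "(x, y) \<in> \<Omega>"
  shows "det (g_low F x y) > 0"
proof -
  define a b c where "a = g_low F x y $ 1 $ 1" "b = g_low F x y $ 1 $ 2" "c = g_low F x y $ 2 $ 2"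
  have b: "g_low F x y $ 2 $ 1 = b"
    using assms by (simp add: a_b_c_def g_low_hessian pdy_F_symmetric[of x y 1 2])
  have pd: "a * u * u + 2 * b * u * w + c * w * w > 0" if "u \<noteq> 0 \<or> w \<noteq> 0" for u w
    using g_posdef[OF assms, of "vector [u, w]"] that b
    by (auto simp: sum_2 a_b_c_def vec_eq_iff forall_2 algebra_simps)
  have a: "a > 0" using pd[of 1 0] by simp
  \<comment> \<open>On the vector \<open>(- b, a)\<close> the form takes the value \<open>a (a c - b b)\<close>.\<close>
  then have "a * (a * c - b * b) > 0"
    using pd[of "- b" a] by (simp add: algebra_simps)
  then show ?thesis using a b by (simp add: det_2 a_b_c_def zero_less_mult_iff)
qed

lemma m_low_explicit:
  "m_low F 1 x y = - sqrt (det (g_low F x y)) * y $ 2 / F x y"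
  "m_low F 2 x y = sqrt (det (g_low F x y)) * y $ 1 / F x y"
  by (simp_all add: m_low_def eps_def gam_def l_up_def sum_2)

lemma y_component_nonzero: "(x, y) \<in> \<Omega> \<Longrightarrow> y $ 1 \<noteq> 0 \<or> y $ 2 \<noteq> 0"
  using nonzero[of x y] by (auto simp: vec_eq_iff forall_2)

text \<open>
  The area form of the metric in the coframe \<open>l, m\<close>. Positivity of the determinant makes \<open>F\<close> and
  \<open>\<theta>\<close> functionally independent on each fibre; the value itself fixes the scale in
  \<open>angular_metric\<close>.
\<close>

lemma F_\<theta>_wronskian:
  assumes "(x, y) \<in> \<Omega>"
  shows "F x y * (pdy F 1 x y * pdy \<theta> 2 x y - pdy F 2 x y * pdy \<theta> 1 x y) = sqrt (det (g_low F x y))"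
proof -
  have F: "F x y \<noteq> 0" using F_pos[OF assms] by simp
  have "F x y * (pdy F 1 x y * pdy \<theta> 2 x y - pdy F 2 x y * pdy \<theta> 1 x y)
     = pdy F 1 x y * m_low F 2 x y - pdy F 2 x y * m_low F 1 x y"
    by (simp add: angle_eq[OF assms, symmetric] algebra_simps)
  also have "\<dots> = sqrt (det (g_low F x y)) * (y $ 1 * pdy F 1 x y + y $ 2 * pdy F 2 x y) / F x y"
    by (simp add: m_low_explicit add_divide_distrib algebra_simps)
  finally show ?thesis using euler_F[OF assms] F by simp
qed

lemma wronskian_nonzero:
  "(x, y) \<in> \<Omega> \<Longrightarrow> pdy F 1 x y * pdy \<theta> 2 x y - pdy F 2 x y * pdy \<theta> 1 x y \<noteq> 0"
  using F_\<theta>_wronskian[of x y] det_g_pos[of x y] by auto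

lemma \<theta>_gradient_nonzero: "(x, y) \<in> \<Omega> \<Longrightarrow> pdy \<theta> 1 x y \<noteq> 0 \<or> pdy \<theta> 2 x y \<noteq> 0"
  using wronskian_nonzero[of x y] by auto

text \<open>
  In classical terms \<open>F F_ij = m_i m_j\<close>, that is \<open>g_ij = l_i l_j + m_i m_j\<close>. The fibre Hessian
  of \<open>F\<close> annihilates \<open>y\<close>, so it equals \<open>J \<theta>_i \<theta>_j\<close> for some \<open>J\<close>; computing
  \<open>det g\<close> from this and from the Wronskian of \<open>F\<close> and \<open>\<theta>\<close> yields \<open>J = F\<close>.
\<close>

lemma angular_metric:
  assumes "(x, y) \<in> \<Omega>"
  shows "pdy (pdy F i) j x y = F x y * pdy \<theta> i x y * pdy \<theta> j x y"
proof -
  obtain J where J: "\<And>i j. pdy (pdy F i) j x y = J * pdy \<theta> i x y * pdy \<theta> j x y"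
    using symmetric_kernel_rank_one[where S = "\<lambda>i j. pdy (pdy F i) j x y" and
          y = "\<lambda>i. y $ i" and \<tau> = "\<lambda>i. pdy \<theta> i x y",
          OF pdy_F_symmetric[OF assms] hessian_F_kernel[OF assms] hessian_F_kernel[OF assms]
            euler_\<theta>[OF assms] y_component_nonzero[OF assms] \<theta>_gradient_nonzero[OF assms]] by blast
  define D where "D = pdy F 1 x y * pdy \<theta> 2 x y - pdy F 2 x y * pdy \<theta> 1 x y"
  have "det (g_low F x y) = F x y * J * D\<^sup>2"
    using assms by (simp add: det_2 g_low_hessian J D_def power2_eq_square algebra_simps)
  moreover have "det (g_low F x y) = (F x y * D)\<^sup>2"
    using F_\<theta>_wronskian[OF assms] det_g_pos[OF assms] by (simp add: D_def)
  ultimately have "F x y * J * D\<^sup>2 = F x y * F x y * D\<^sup>2"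
    by algebra
  then have "J = F x y"
    using F_pos[OF assms] wronskian_nonzero[OF assms] by (simp add: D_def)
  then show ?thesis using J by simp
qed

text \<open>
  Adding \<open>F_i \<theta>_j + F_j \<theta>_i\<close> to \<open>F \<theta>_ij\<close> compensates for \<open>\<theta>_ij y^j = - \<theta>_i\<close>
  and produces a symmetric form with \<open>y\<close> in its kernel. The scalar \<open>J\<close> is, up to normalisation,
  the main scalar of the surface.
\<close>

lemma hessian_\<theta>:
  assumes "(x, y) \<in> \<Omega>"
  obtains J where "\<And>i j. F x y * pdy (pdy \<theta> i) j x y =
    J * pdy \<theta> i x y * pdy \<theta> j x y - pdy F i x y * pdy \<theta> j x y - pdy F j x y * pdy \<theta> i x y"
proof -
  let ?S = "\<lambda>i j. F x y * pdy (pdy \<theta> i) j x y + pdy F i x y * pdy \<theta> j x y + pdy F j x y * pdy \<theta> i x y"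
  have ker: "?S i 1 * y $ 1 + ?S i 2 * y $ 2 = 0" for i
  proof -
    have "?S i 1 * y $ 1 + ?S i 2 * y $ 2 =
      F x y * (pdy (pdy \<theta> i) 1 x y * y $ 1 + pdy (pdy \<theta> i) 2 x y * y $ 2)
      + pdy F i x y * (y $ 1 * pdy \<theta> 1 x y + y $ 2 * pdy \<theta> 2 x y)
      + (y $ 1 * pdy F 1 x y + y $ 2 * pdy F 2 x y) * pdy \<theta> i x y"
      by (simp add: algebra_simps)
    then show ?thesis
      using assms by (simp add: hessian_\<theta>_euler euler_\<theta> euler_F)
  qed
  have sym: "?S 1 2 = ?S 2 1"
    using pdy_\<theta>_symmetric[OF assms, of 1 2] by simp
  obtain J where "\<And>i j. ?S i j = J * pdy \<theta> i x y * pdy \<theta> j x y"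
    using symmetric_kernel_rank_one[where S = ?S and
          y = "\<lambda>i. y $ i" and \<tau> = "\<lambda>i. pdy \<theta> i x y",
          OF sym ker ker euler_\<theta>[OF assms] y_component_nonzero[OF assms] \<theta>_gradient_nonzero[OF assms]] by blast
  then show ?thesis by (intro that[of J]) (simp add: eq_diff_eq add_ac)
qed

text \<open>
  The vector \<open>m^i\<close> is dual to \<open>m_i\<close> in the frame \<open>l, m\<close>. Lower the index, \<open>g_ij m^j = m_i\<close>,
  insert \<open>g_ij = l_i l_j + m_i m_j\<close>, and compare the components along \<open>l_i\<close> and \<open>m_i\<close>; these are
  separated by contracting with \<open>y^i\<close>.
\<close>

lemma m_up_pairings:
  assumes "(x, y) \<in> \<Omega>"
  shows "pdy F 1 x y * m_up F 1 x y + pdy F 2 x y * m_up F 2 x y = 0"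
    and "F x y * (pdy \<theta> 1 x y * m_up F 1 x y + pdy \<theta> 2 x y * m_up F 2 x y) = 1"
proof -
  have F: "F x y \<noteq> 0" using F_pos[OF assms] by simp
  define \<alpha> where "\<alpha> = pdy F 1 x y * m_up F 1 x y + pdy F 2 x y * m_up F 2 x y"
  define \<beta> where "\<beta> = F x y * (pdy \<theta> 1 x y * m_up F 1 x y + pdy \<theta> 2 x y * m_up F 2 x y)"
  have "invertible (g_low F x y)"
    using det_g_pos[OF assms] by (simp add: invertible_det_nz)
  then have "g_low F x y *v (g_up F x y *v (\<chi> j. m_low F j x y)) = (\<chi> j. m_low F j x y)"
    by (simp add: g_up_def matrix_vector_mul_assoc matrix_inv_def invertible_def
        someI_ex[of "\<lambda>B. g_low F x y ** B = mat 1 \<and> B ** g_low F x y = mat 1"])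
  moreover have "g_up F x y *v (\<chi> j. m_low F j x y) = (\<chi> i. m_up F i x y)"
    by (simp add: matrix_vector_mult_def m_up_def)
  ultimately have "(g_low F x y *v (\<chi> i. m_up F i x y)) $ i = m_low F i x y" for i
    by simp
  then have "(pdy F i x y * pdy F 1 x y + F x y * (F x y * pdy \<theta> i x y * pdy \<theta> 1 x y)) * m_up F 1 x y
      + (pdy F i x y * pdy F 2 x y + F x y * (F x y * pdy \<theta> i x y * pdy \<theta> 2 x y)) * m_up F 2 x y
      = F x y * pdy \<theta> i x y" for i
    by (simp add: matrix_vector_mult_def sum_2 g_low_hessian[OF assms] angular_metric[OF assms] angle_eq[OF assms])
  note pair = this
  have eq: "pdy F i x y * \<alpha> + F x y * pdy \<theta> i x y * \<beta> = F x y * pdy \<theta> i x y" for i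
    unfolding \<alpha>_def \<beta>_def using pair[of i] by algebra
  have "F x y * \<alpha> = 0"
    using eq[of 1] eq[of 2] euler_F[OF assms] euler_\<theta>[OF assms] by algebra
  then have l: "\<alpha> = 0" using F by simp
  then show "pdy F 1 x y * m_up F 1 x y + pdy F 2 x y * m_up F 2 x y = 0" by (simp add: \<alpha>_def)
  have "\<beta> = 1" using eq[of 1] eq[of 2] l F \<theta>_gradient_nonzero[OF assms] by auto
  then show "F x y * (pdy \<theta> 1 x y * m_up F 1 x y + pdy \<theta> 2 x y * m_up F 2 x y) = 1"
    by (simp add: \<beta>_def)
qed

section \<open>The connection coefficients\<close>

lemma Ncoef_F:
  assumes "(x, y) \<in> \<Omega>"
  shows "pdy F 1 x y * Ncoef F \<theta> \<kappa> 1 n x y + pdy F 2 x y * Ncoef F \<theta> \<kappa> 2 n x y = - pdx F n x y"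
proof -
  have F: "F x y \<noteq> 0" using F_pos[OF assms] by simp
  have "pdy F 1 x y * Ncoef F \<theta> \<kappa> 1 n x y + pdy F 2 x y * Ncoef F \<theta> \<kappa> 2 n x y =
    - ((y $ 1 * pdy F 1 x y + y $ 2 * pdy F 2 x y) / F x y) * pdx F n x y
    - F x y * (pdy F 1 x y * m_up F 1 x y + pdy F 2 x y * m_up F 2 x y) * (pdx \<theta> n x y - \<kappa> x $ n)"
    by (simp add: Ncoef_def l_up_def add_divide_distrib algebra_simps)
  then show ?thesis using F by (simp add: m_up_pairings[OF assms] euler_F[OF assms])
qed

lemma Ncoef_\<theta>:
  assumes "(x, y) \<in> \<Omega>"
  shows "pdy \<theta> 1 x y * Ncoef F \<theta> \<kappa> 1 n x y + pdy \<theta> 2 x y * Ncoef F \<theta> \<kappa> 2 n x y = \<kappa> x $ n - pdx \<theta> n x y"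
proof -
  have "pdy \<theta> 1 x y * Ncoef F \<theta> \<kappa> 1 n x y + pdy \<theta> 2 x y * Ncoef F \<theta> \<kappa> 2 n x y =
    - ((y $ 1 * pdy \<theta> 1 x y + y $ 2 * pdy \<theta> 2 x y) / F x y) * pdx F n x y
    - (F x y * (pdy \<theta> 1 x y * m_up F 1 x y + pdy \<theta> 2 x y * m_up F 2 x y)) * (pdx \<theta> n x y - \<kappa> x $ n)"
    by (simp add: Ncoef_def l_up_def add_divide_distrib algebra_simps)
  then show ?thesis by (simp add: m_up_pairings[OF assms] euler_\<theta>[OF assms])
qed

text \<open>
  The definition of \<open>N^k_n\<close> goes through the inverse matrix and a square root; solving the linear
  system of \<open>Ncoef_F\<close> and \<open>Ncoef_\<theta>\<close> by Cramer's rule expresses it rationally in \<open>\<kappa>\<close> and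
  the first derivatives of \<open>F\<close> and \<open>\<theta>\<close> instead.
\<close>

lemma C_on_Ncoef:
  assumes C_\<kappa>: "\<And>n. C_on 2 \<Omega> (on_pairs (\<lambda>x y. \<kappa> x $ n))"
  shows "C_on 2 \<Omega> (on_pairs (Ncoef F \<theta> \<kappa> k n))"
proof -
  define D where "D x y = pdy F 1 x y * pdy \<theta> 2 x y - pdy F 2 x y * pdy \<theta> 1 x y" for x y
  define b where "b x y = \<kappa> x $ n - pdx \<theta> n x y" for x y
  have D: "D x y \<noteq> 0" if "(x, y) \<in> \<Omega>" for x y
    using wronskian_nonzero[OF that] by (simp add: D_def)
  have CF: "C_on 2 \<Omega> (on_pairs (pdy F k))" "C_on 2 \<Omega> (on_pairs (pdx F k))" for k
    by (rule C_on_mono[OF C_Fy] C_on_mono[OF C_Fx]; simp)+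
  have CD: "C_on 2 \<Omega> (on_pairs D)" and Cb: "C_on 2 \<Omega> (on_pairs b)"
    unfolding D_def b_def by (intro C_on_diff C_on_mult open_\<Omega> CF C_\<theta>y C_\<theta>x C_\<kappa>)+
  have "C_on 2 \<Omega> (on_pairs (\<lambda>x y. (- pdx F n x y * pdy \<theta> 2 x y - b x y * pdy F 2 x y) / D x y))"
    "C_on 2 \<Omega> (on_pairs (\<lambda>x y. (pdy F 1 x y * b x y + pdy \<theta> 1 x y * pdx F n x y) / D x y))"
    by (intro C_on_divide C_on_add C_on_diff C_on_mult C_on_minus open_\<Omega> CF C_\<theta>y C_\<theta>x CD Cb;
        use D in auto)+
  moreover have "Ncoef F \<theta> \<kappa> 1 n x y = (- pdx F n x y * pdy \<theta> 2 x y - b x y * pdy F 2 x y) / D x y"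
    "Ncoef F \<theta> \<kappa> 2 n x y = (pdy F 1 x y * b x y + pdy \<theta> 1 x y * pdx F n x y) / D x y"
    if "(x, y) \<in> \<Omega>" for x y
    unfolding nonzero_eq_divide_eq[OF D[OF that]]
    using Ncoef_F[OF that, of \<kappa> n] Ncoef_\<theta>[OF that, of \<kappa> n, folded b_def]
    unfolding D_def by algebra+
  ultimately have "C_on 2 \<Omega> (on_pairs (Ncoef F \<theta> \<kappa> 1 n))" "C_on 2 \<Omega> (on_pairs (Ncoef F \<theta> \<kappa> 2 n))"
    by (auto intro: C_on_cong[OF open_\<Omega>, rotated] simp del: C_on.simps)
  then show ?thesis using exhaust_2[of k] by metis
qed

text \<open>
  The fibre derivative of \<open>Ncoef_F\<close>. By \<open>angular_metric\<close> the term \<open>F_km N^k_n\<close> is a multiple of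
  \<open>\<theta>_k N^k_n\<close>, which \<open>Ncoef_\<theta>\<close> evaluates.
\<close>

lemma fibre_derivative_Ncoef_F:
  assumes C_\<kappa>: "\<And>n. C_on 2 \<Omega> (on_pairs (\<lambda>x y. \<kappa> x $ n))" and xy: "(x, y) \<in> \<Omega>"
  shows "pdy F 1 x y * Ncoef1 F \<theta> \<kappa> 1 n m x y + pdy F 2 x y * Ncoef1 F \<theta> \<kappa> 2 n m x y =
    - pdx (pdy F m) n x y - F x y * pdy \<theta> m x y * (\<kappa> x $ n - pdx \<theta> n x y)"
proof -
  note dN = C_on_differentiable[OF C_on_Ncoef[OF C_\<kappa>], OF _ xy]
  have "pdy (\<lambda>x y. pdy F 1 x y * Ncoef F \<theta> \<kappa> 1 n x y + pdy F 2 x y * Ncoef F \<theta> \<kappa> 2 n x y) m x y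
      = pdy (\<lambda>x y. - pdx F n x y) m x y"
    by (rule pdy_cong[OF open_\<Omega> xy Ncoef_F])
  also have "\<dots> = - pdx (pdy F m) n x y"
    using xy pdy_pdx_commute[OF open_\<Omega> xy C_on_mono[OF C_F]] by (simp add: pdy_minus diff_rules)
  finally have "(pdy (pdy F 1) m x y * Ncoef F \<theta> \<kappa> 1 n x y + pdy (pdy F 2) m x y * Ncoef F \<theta> \<kappa> 2 n x y)
      + (pdy F 1 x y * Ncoef1 F \<theta> \<kappa> 1 n m x y + pdy F 2 x y * Ncoef1 F \<theta> \<kappa> 2 n m x y)
      = - pdx (pdy F m) n x y"
    using xy by (simp add: pdy_pairing diff_rules dN Ncoef1_def)
  moreover have "pdy (pdy F 1) m x y * Ncoef F \<theta> \<kappa> 1 n x y + pdy (pdy F 2) m x y * Ncoef F \<theta> \<kappa> 2 n x y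
      = F x y * pdy \<theta> m x y * (pdy \<theta> 1 x y * Ncoef F \<theta> \<kappa> 1 n x y + pdy \<theta> 2 x y * Ncoef F \<theta> \<kappa> 2 n x y)"
    by (simp add: angular_metric[OF xy] algebra_simps)
  ultimately show ?thesis unfolding Ncoef_\<theta>[OF xy] by linarith
qed

lemma fibre_derivative_Ncoef_\<theta>:
  assumes C_\<kappa>: "\<And>n. C_on 2 \<Omega> (on_pairs (\<lambda>x y. \<kappa> x $ n))" and xy: "(x, y) \<in> \<Omega>"
  shows "pdy \<theta> 1 x y * Ncoef1 F \<theta> \<kappa> 1 n m x y + pdy \<theta> 2 x y * Ncoef1 F \<theta> \<kappa> 2 n m x y =
    - pdx (pdy \<theta> m) n x y
    - (pdy (pdy \<theta> 1) m x y * Ncoef F \<theta> \<kappa> 1 n x y + pdy (pdy \<theta> 2) m x y * Ncoef F \<theta> \<kappa> 2 n x y)"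
proof -
  note dN = C_on_differentiable[OF C_on_Ncoef[OF C_\<kappa>], OF _ xy]
  note d\<kappa> = C_on_differentiable[OF C_\<kappa>, OF _ xy]
  have "pdy (\<lambda>x y. pdy \<theta> 1 x y * Ncoef F \<theta> \<kappa> 1 n x y + pdy \<theta> 2 x y * Ncoef F \<theta> \<kappa> 2 n x y) m x y
      = pdy (\<lambda>x y. \<kappa> x $ n - pdx \<theta> n x y) m x y"
    by (rule pdy_cong[OF open_\<Omega> xy Ncoef_\<theta>])
  also have "\<dots> = - pdx (pdy \<theta> m) n x y"
    using xy pdy_pdx_commute[OF open_\<Omega> xy C_on_mono[OF C_\<theta>]]
    by (simp add: pdy_diff diff_rules d\<kappa> pdy_base)
  finally have "(pdy (pdy \<theta> 1) m x y * Ncoef F \<theta> \<kappa> 1 n x y + pdy (pdy \<theta> 2) m x y * Ncoef F \<theta> \<kappa> 2 n x y)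
      + (pdy \<theta> 1 x y * Ncoef1 F \<theta> \<kappa> 1 n m x y + pdy \<theta> 2 x y * Ncoef1 F \<theta> \<kappa> 2 n m x y)
      = - pdx (pdy \<theta> m) n x y"
    using xy by (simp add: pdy_pairing diff_rules dN Ncoef1_def)
  then show ?thesis by linarith
qed

lemma pdx_angular_metric:
  assumes xy: "(x, y) \<in> \<Omega>"
  shows "pdx (pdy (pdy F m) i) n x y = pdx F n x y * pdy \<theta> m x y * pdy \<theta> i x y
    + F x y * (pdx (pdy \<theta> m) n x y * pdy \<theta> i x y + pdy \<theta> m x y * pdx (pdy \<theta> i) n x y)"
proof -
  have "pdx (pdy (pdy F m) i) n x y = pdx (\<lambda>x y. F x y * (pdy \<theta> m x y * pdy \<theta> i x y)) n x y"
    by (rule pdx_cong[OF open_\<Omega> xy]) (simp add: angular_metric)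
  then show ?thesis
    using xy by (simp add: pdx_mult diff_rules differentiable_mult algebra_simps)
qed

text \<open>
  Differentiate \<open>fibre_derivative_Ncoef_F\<close> once more and substitute. What is left after the mixed
  derivatives of \<open>\<theta>\<close> have cancelled is, with \<open>b = \<kappa>_n - \<theta>_;n\<close>,
    \<open>F_k N^k_nmi = - F_;n \<theta>_m \<theta>_i - b (F_i \<theta>_m + F \<theta>_mi) + F \<theta>_i \<theta>_km N^k_n\<close>,
  and \<open>hessian_\<theta>\<close> together with the linear system for \<open>N^k_n\<close> reduces the right-hand side to zero.
\<close>

lemma y_low_Ncoef2:
  assumes C_\<kappa>: "\<And>n. C_on 2 \<Omega> (on_pairs (\<lambda>x y. \<kappa> x $ n))" and xy: "(x, y) \<in> \<Omega>"
  shows "y_low F 1 x y * Ncoef2 F \<theta> \<kappa> 1 n m i x y + y_low F 2 x y * Ncoef2 F \<theta> \<kappa> 2 n m i x y = 0"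
proof -
  have dN1: "on_pairs (Ncoef1 F \<theta> \<kappa> k n m) differentiable (at (x, y))" for k
    unfolding Ncoef1_def
    by (rule C_on_differentiable[OF C_on_pdy[OF open_\<Omega> C_on_mono[OF C_on_Ncoef[OF C_\<kappa>]]], of 1])
      (simp_all add: xy)
  note d\<kappa> = C_on_differentiable[OF C_\<kappa>, OF _ xy]
  have dFxm: "on_pairs (pdx (pdy F m) n) differentiable (at (x, y))"
    by (rule C_on_differentiable[OF C_on_pdx[OF open_\<Omega> C_on_mono[OF C_Fy]], of 1]) (simp_all add: xy)
  define b where "b = \<kappa> x $ n - pdx \<theta> n x y"
  define N where "N k = Ncoef F \<theta> \<kappa> k n x y" for k
  define N1 where "N1 k j = Ncoef1 F \<theta> \<kappa> k n j x y" for k j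
  define N2 where "N2 k = Ncoef2 F \<theta> \<kappa> k n m i x y" for k
  have "pdy (\<lambda>x y. pdy F 1 x y * Ncoef1 F \<theta> \<kappa> 1 n m x y + pdy F 2 x y * Ncoef1 F \<theta> \<kappa> 2 n m x y) i x y
      = pdy (\<lambda>x y. - pdx (pdy F m) n x y - F x y * pdy \<theta> m x y * (\<kappa> x $ n - pdx \<theta> n x y)) i x y"
    by (rule pdy_cong[OF open_\<Omega> xy fibre_derivative_Ncoef_F[OF C_\<kappa>]])
  also have "\<dots> = - pdx (pdy (pdy F m) i) n x y - (pdy F i x y * pdy \<theta> m x y * b
      + F x y * pdy (pdy \<theta> m) i x y * b - F x y * pdy \<theta> m x y * pdx (pdy \<theta> i) n x y)"
    using xy pdy_pdx_commute[OF open_\<Omega> xy C_on_mono[OF C_\<theta>]]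
      pdy_pdx_commute[OF open_\<Omega> xy C_on_mono[OF C_Fy]]
    by (simp add: pdy_diff pdy_minus pdy_mult pdy_base diff_rules d\<kappa> dFxm differentiable_mult
        differentiable_diff differentiable_minus b_def)
      (simp add: algebra_simps)
  finally have "(pdy (pdy F 1) i x y * N1 1 m + pdy (pdy F 2) i x y * N1 2 m)
      + (pdy F 1 x y * N2 1 + pdy F 2 x y * N2 2) = \<dots>"
    using xy by (simp add: pdy_pairing diff_rules dN1 Ncoef2_def N1_def N2_def)
  moreover have "pdy (pdy F 1) i x y * N1 1 m + pdy (pdy F 2) i x y * N1 2 m =
      F x y * pdy \<theta> i x y * (pdy \<theta> 1 x y * N1 1 m + pdy \<theta> 2 x y * N1 2 m)"
    by (simp add: angular_metric[OF xy] algebra_simps)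
  moreover have "pdy \<theta> 1 x y * N1 1 m + pdy \<theta> 2 x y * N1 2 m = - pdx (pdy \<theta> m) n x y
      - (pdy (pdy \<theta> 1) m x y * N 1 + pdy (pdy \<theta> 2) m x y * N 2)"
    using fibre_derivative_Ncoef_\<theta>[OF C_\<kappa> xy] by (simp add: N_def N1_def)
  ultimately have "pdy F 1 x y * N2 1 + pdy F 2 x y * N2 2 =
      - pdx F n x y * pdy \<theta> m x y * pdy \<theta> i x y - pdy F i x y * pdy \<theta> m x y * b
      - F x y * pdy (pdy \<theta> m) i x y * b
      + F x y * pdy \<theta> i x y * (pdy (pdy \<theta> 1) m x y * N 1 + pdy (pdy \<theta> 2) m x y * N 2)"
    unfolding pdx_angular_metric[OF xy] by algebra
  moreover obtain J where "\<And>i j. F x y * pdy (pdy \<theta> i) j x y =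
    J * pdy \<theta> i x y * pdy \<theta> j x y - pdy F i x y * pdy \<theta> j x y - pdy F j x y * pdy \<theta> i x y"
    using hessian_\<theta>[OF xy] by blast
  note this[of 1 m] this[of 2 m] this[of m i]
  moreover have "pdy F 1 x y * N 1 + pdy F 2 x y * N 2 = - pdx F n x y"
    "pdy \<theta> 1 x y * N 1 + pdy \<theta> 2 x y * N 2 = b"
    using Ncoef_F[OF xy] Ncoef_\<theta>[OF xy] by (simp_all add: N_def b_def)
  ultimately have "pdy F 1 x y * N2 1 + pdy F 2 x y * N2 2 = 0"
    by algebra
  then show ?thesis by (simp add: y_low_def N2_def mult.assoc flip: distrib_left)
qed

end

theorem mainTheorem1:
  fixes U :: "(real^2) set" and \<Omega> :: "((real^2) \<times> (real^2)) set"
    and F \<theta> :: "real^2 \<Rightarrow> real^2 \<Rightarrow> real" and \<kappa> :: "real^2 \<Rightarrow> real^2"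
  assumes "conic_region U \<Omega>"
    and "finsler_metric_on \<Omega> F"
    and "angle_function_on \<Omega> F \<theta>"
    and "smooth_on U \<kappa>"
  shows "\<forall>(x, y)\<in>\<Omega>.
      (\<forall>n. d_op F \<theta> \<kappa> n F x y = 0) \<and>
      (\<forall>n. d_op F \<theta> \<kappa> n \<theta> x y = \<kappa> x $ n) \<and>
      (\<forall>n m i. (\<Sum>k\<in>UNIV. y_low F k x y * Ncoef2 F \<theta> \<kappa> k n m i x y) = 0)"
proof -
  have U: "open U" "open \<Omega>" "\<Omega> \<subseteq> U \<times> (- {0})"
    using assms(1) by (simp_all add: conic_region_def)
  interpret finsler_surface \<Omega> F \<theta>
    using U assms(2,3) by unfold_locales auto
  have "C_on 2 U \<kappa>" using assms(4) unfolding smooth_on_def by blast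
  then have "C_on 2 \<Omega> (\<lambda>p. \<kappa> (fst p))"
    using U by (intro C_on_compose_linear[OF bounded_linear_fst, of \<Omega> U]) auto
  then have C_\<kappa>: "C_on 2 \<Omega> (on_pairs (\<lambda>x y. \<kappa> x $ n))" for n
    by (rule C_on_bounded_linear_left[OF bounded_linear_vec_nth U(2)])
  show ?thesis
    using y_low_Ncoef2[OF C_\<kappa>] Ncoef_F[of _ _ \<kappa>] Ncoef_\<theta>[of _ _ \<kappa>]
    by (auto simp: d_op_def sum_2 mult.commute)
qed

end
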